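(* Let $A,B$ be zonoids in $\mathbb{R}^3$ and let $u\in S^2$ be such that $|P_{u^\perp}A|_2>0$. Then $$\frac{|A+B|}{|P_{u^\perp}(A+B)|_2}\ge\frac{|A|}{|P_{u^\perp}A|_2}.$$
   Context: A zonotope is a finite Minkowski sum of segments; a zonoid is a limit of zonotopes in the Hausdorff metric. $|\cdot|$ is 3-dimensional volume, $|\cdot|_2$ is 2-dimensional volume, $+$ is Minkowski sum, and $P_{u^\perp}$ is the orthogonal projection onto the plane $u^\perp$ orthogonal to $u$. *)

theory Defs
  imports "HOL-Analysis.Analysis"
begin

(* Minkowski sums are the operations + and sum on sets from HOL-Library.Set_Algebras;
   the empty sum is {0}. *)
definition zonotope :: "'a::euclidean_space set \<Rightarrow> bool" where
  "zonotope Z \<longleftrightarrow>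
     (\<exists>(n::nat) (a :: nat \<Rightarrow> 'a) (b :: nat \<Rightarrow> 'a). Z = (\<Sum>i<n. closed_segment (a i) (b i)))"

(* Only meaningful for bounded nonempty sets: SUP and infdist are junk otherwise. *)
definition hausdorff_dist :: "'a::metric_space set \<Rightarrow> 'a set \<Rightarrow> real" where
  "hausdorff_dist A B = max (SUP x\<in>A. infdist x B) (SUP y\<in>B. infdist y A)"

(* The limit is taken in the metric space of nonempty compact sets. *)
definition zonoid :: "'a::euclidean_space set \<Rightarrow> bool" where
  "zonoid K \<longleftrightarrow> compact K \<and> K \<noteq> {} \<and>
     (\<exists>Z :: nat \<Rightarrow> 'a set. (\<forall>n. zonotope (Z n)) \<and> (\<lambda>n. hausdorff_dist (Z n) K) \<longlonglongrightarrow> 0)"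

definition perp_plane :: "real^3 \<Rightarrow> (real^3) set" where
  "perp_plane u = {x. orthogonal u x}"

(* Orthogonal projection onto the plane orthogonal to u, for a unit vector u. *)
definition perp_proj :: "real^3 \<Rightarrow> real^3 \<Rightarrow> real^3" where
  "perp_proj u x = x - (x \<bullet> u) *\<^sub>R u"

definition plane_chart :: "real^3 \<Rightarrow> (real^2 \<Rightarrow> real^3) \<Rightarrow> bool" where
  "plane_chart u f \<longleftrightarrow> orthogonal_transformation f \<and> range f = perp_plane u"

(* Area in the plane orthogonal to u: Lebesgue measure transported along a linear isometry
   from real^2. The choice of isometry is immaterial, see plane_area_eq. *)
definition plane_area :: "real^3 \<Rightarrow> (real^3) set \<Rightarrow> real" where
  "plane_area u S = measure lebesgue ((SOME f. plane_chart u f) -` S)"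

lemma plane_chart_exists:
  assumes "u \<noteq> 0"
  shows "\<exists>f. plane_chart u f"
proof -
  have "dim (perp_plane u) = 2"
    using dim_hyperplane[OF assms] by (simp add: perp_plane_def orthogonal_def)
  then have "dim (UNIV :: (real^2) set) = dim (perp_plane u)"
    by simp
  moreover have "subspace (perp_plane u)"
    unfolding perp_plane_def orthogonal_def by (rule subspace_hyperplane)
  ultimately obtain f where "linear f" "f ` (UNIV :: (real^2) set) = perp_plane u"
      "\<And>x. x \<in> UNIV \<Longrightarrow> norm (f x) = norm x"
    using isometries_subspaces[of "UNIV :: (real^2) set" "perp_plane u"] by (metis subspace_UNIV)
  then show ?thesis
    unfolding plane_chart_def orthogonal_transformation by auto
qed

lemma plane_area_eq:
  assumes "plane_chart u f"
  shows "plane_area u S = measure lebesgue (f -` S)"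
proof -
  define g where "g = (SOME f. plane_chart u f)"
  have g: "plane_chart u g"
    unfolding g_def using someI[of "plane_chart u"] assms .
  have f': "linear f" "\<And>y. norm (f y) = norm y" "range f = perp_plane u"
    and g': "linear g" "\<And>y. norm (g y) = norm y" "range g = perp_plane u"
    using assms g by (auto simp: plane_chart_def orthogonal_transformation)
  have "inj f"
    unfolding linear_injective_0[OF f'(1)] by (metis f'(2) norm_eq_zero)
  define h where "h = (\<lambda>y. inv f (g y))"
  have fh: "f (h y) = g y" for y
    unfolding h_def using f'(3) g'(3) by (metis f_inv_into_f rangeI)
  have "linear h"
    by (rule linearI; rule injD[OF \<open>inj f\<close>])
      (simp_all add: fh linear_add[OF f'(1)] linear_add[OF g'(1)]
        linear_scale[OF f'(1)] linear_scale[OF g'(1)])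
  moreover have "norm (h y) = norm y" for y
    by (metis fh f'(2) g'(2))
  ultimately have h: "orthogonal_transformation h"
    by (simp add: orthogonal_transformation)
  then have bij: "bij h"
    by (rule orthogonal_transformation_bij)
  have img: "f -` S = h ` (g -` S)"
  proof -
    have "x \<in> h ` (g -` S)" if "f x \<in> S" for x
    proof -
      obtain y where "x = h y"
        using bij_is_surj[OF bij] by (rule surjE)
      with that show ?thesis
        by (simp add: fh)
    qed
    then show ?thesis
      by (auto simp: fh)
  qed
  have null: "measure lebesgue T = 0" if "T \<notin> lmeasurable" for T :: "(real^2) set"
  proof (cases "T \<in> sets lebesgue")
    case True
    with that have "emeasure lebesgue T = top"
      by (metis fmeasurableI infinity_ennreal_def top.not_eq_extremum)
    then show ?thesis
      by (simp only: measure_def enn2real_top)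
  qed (simp add: measure_notin_sets)
  have "measure lebesgue (h ` (g -` S)) = measure lebesgue (g -` S)"
  proof (cases "g -` S \<in> lmeasurable")
    case True
    then show ?thesis
      by (rule measure_orthogonal_image[OF h])
  next
    case False
    have "inv h ` (h ` (g -` S)) = g -` S"
      using bij by (simp add: bij_is_inj image_inv_f_f)
    then have "h ` (g -` S) \<notin> lmeasurable"
      using False measurable_orthogonal_image[OF orthogonal_transformation_inv[OF h]] by metis
    with False show ?thesis
      by (simp add: null)
  qed
  then show ?thesis
    unfolding plane_area_def g_def[symmetric] img by simp
qed

end

(*
  Outer approximation by zonotopes reduces the claim to zonotopes, and adding the segments of B one
  at a time reduces it to the case where B is a segment [0,v] and A is a sum of segments [0,x_i].
  By Cavalieri's principle the volume of A, its shadows along u and v, and its width transversal to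
  u and v are sums of absolute values of the determinants det(x_i,x_j,x_k), det(x_i,x_j,u),
  det(x_i,x_j,v), det(x_i,u,v), and the claim becomes

    |A| * sum_i |det(x_i,u,v)|  <=  sum_{i<j} |det(x_i,x_j,u)| * sum_{i<j} |det(x_i,x_j,v)|.

  Take u and v as the first two coordinate directions and write x_i = t_i (a_i,b_i,1) with t_i > 0.
  The left side is subadditive in a, while the right side is additive along the decomposition of a
  into indicators of its superlevel sets, and likewise for b. So a and b may be taken to be 0/1-valued.
  If p_rs is the total weight of the indices with (a_i,b_i) = (r,s), the right side then exceeds
  the left side by (p_00 p_11 - p_01 p_10)^2.
*)
theory Submission
  imports Defs
begin

section \<open>The determinant inequality\<close>

text \<open>Induction on the number of values of \<open>a\<close> on \<open>I\<close>: cutting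
  \<open>a\<close> off at its second largest value \<open>m\<close> removes the largest value
  \<open>M\<close>, and what was cut off is \<open>M - m\<close> times the indicator of the
  superlevel set where \<open>m < a i\<close>. Both parts are nondecreasing functions of
  \<open>a\<close>, so their differences never cancel and the absolute differences add up
  exactly.\<close>

lemma finite_levels_induct [consumes 1, case_names const indicator step]:
  fixes a :: "'i \<Rightarrow> real"
  assumes "finite I"
    and const: "\<And>a c. (\<And>i. i \<in> I \<Longrightarrow> a i = c) \<Longrightarrow> P a"
    and ind: "\<And>a. (\<And>i. a i \<in> {0, 1}) \<Longrightarrow> P a"
    and step: "\<And>a b c h. P b \<Longrightarrow> P h \<Longrightarrow> 0 \<le> c \<Longrightarrow> (\<And>i. i \<in> I \<Longrightarrow> a i = b i + c * h i) \<Longrightarrow>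
        (\<And>i j. i \<in> I \<Longrightarrow> j \<in> I \<Longrightarrow> \<bar>a i - a j\<bar> = \<bar>b i - b j\<bar> + c * \<bar>h i - h j\<bar>) \<Longrightarrow> P a"
  shows "P a"
proof (induction "card (a ` I)" arbitrary: a rule: less_induct)
  case less
  show ?case
  proof (cases "\<exists>c. \<forall>i\<in>I. a i = c")
    case True
    then show ?thesis using const by blast
  next
    case False
    define M where "M = Max (a ` I)"
    define m where "m = Max (a ` I - {M})"
    have ne: "a ` I - {M} \<noteq> {}" using False by blast
    have fin: "finite (a ` I)" using \<open>finite I\<close> by simp
    have m: "m \<in> a ` I - {M}" unfolding m_def using fin ne by (intro Max_in) auto
    have Mle: "a i \<le> M" if "i \<in> I" for i unfolding M_def using fin that by auto
    have mle: "a i \<le> m \<or> a i = M" if "i \<in> I" for i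
    proof (cases "a i = M")
      case False
      then have "a i \<le> m" unfolding m_def using fin that by (intro Max_ge) auto
      then show ?thesis ..
    qed simp
    have "m < M" using m Mle by force
    have "M \<in> a ` I" unfolding M_def using fin ne by (intro Max_in) auto
    have "(\<lambda>i. min (a i) m) ` I \<subseteq> a ` I - {M}"
      using m \<open>m < M\<close> mle by (auto simp: min_def)
    also have "\<dots> \<subset> a ` I" using \<open>M \<in> a ` I\<close> by blast
    finally have "card ((\<lambda>i. min (a i) m) ` I) < card (a ` I)"
      using fin by (intro psubset_card_mono)
    then have "P (\<lambda>i. min (a i) m)" by (rule less)
    moreover have "P (\<lambda>i. of_bool (m < a i))" by (rule ind) auto
    ultimately show ?thesis
    proof (rule step)
      show "0 \<le> M - m" using \<open>m < M\<close> by simp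
      show eq: "a i = min (a i) m + (M - m) * of_bool (m < a i)" if "i \<in> I" for i
        using mle[OF that] \<open>m < M\<close> by auto
      show "\<bar>a i - a j\<bar> = \<bar>min (a i) m - min (a j) m\<bar>
          + (M - m) * \<bar>of_bool (m < a i) - of_bool (m < a j)\<bar>" if "i \<in> I" "j \<in> I" for i j
        using mle[OF that(1)] mle[OF that(2)] \<open>m < M\<close> by (auto simp: min_def)
    qed
  qed
qed

section \<open>Weighted triangle areas and distances\<close>

text \<open>Twice the signed area of the triangle with vertices \<open>(a i, b i)\<close>,
  \<open>(a j, b j)\<close>, \<open>(a k, b k)\<close>; equivalently the determinant with rows
  \<open>(a i, b i, 1)\<close>, \<open>(a j, b j, 1)\<close>, \<open>(a k, b k, 1)\<close>.\<close>

definition tri :: "('i \<Rightarrow> real) \<Rightarrow> ('i \<Rightarrow> real) \<Rightarrow> 'i \<Rightarrow> 'i \<Rightarrow> 'i \<Rightarrow> real" where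
  "tri a b i j k = (a i - a k) * (b j - b k) - (a j - a k) * (b i - b k)"

definition triangle_sum where
  "triangle_sum I t a b = (\<Sum>i\<in>I. \<Sum>j\<in>I. \<Sum>k\<in>I. t i * t j * t k * \<bar>tri a b i j k\<bar>)"

definition distance_sum :: "'i set \<Rightarrow> ('i \<Rightarrow> real) \<Rightarrow> ('i \<Rightarrow> real) \<Rightarrow> real" where
  "distance_sum I t a = (\<Sum>i\<in>I. \<Sum>j\<in>I. t i * t j * \<bar>a i - a j\<bar>)"

lemma triangle_sum_commute: "triangle_sum I t a b = triangle_sum I t b a"
proof -
  have "\<bar>tri a b i j k\<bar> = \<bar>tri b a i j k\<bar>" for i j k
    by (simp add: tri_def abs_minus_commute mult.commute)
  then show ?thesis by (simp add: triangle_sum_def)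
qed

text \<open>\<open>tri\<close> is linear in its first argument, and the triangle inequality does the
  rest. Subadditivity suffices since this sum stands on the smaller side of the final
  inequality.\<close>

lemma triangle_sum_add_le:
  assumes "\<And>i. i \<in> I \<Longrightarrow> 0 \<le> t i" "0 \<le> c" "\<And>i. i \<in> I \<Longrightarrow> a i = a' i + c * h i"
  shows "triangle_sum I t a b \<le> triangle_sum I t a' b + c * triangle_sum I t h b"
proof -
  have "t i * t j * t k * \<bar>tri a b i j k\<bar>
      \<le> t i * t j * t k * \<bar>tri a' b i j k\<bar> + c * (t i * t j * t k * \<bar>tri h b i j k\<bar>)"
    if "i \<in> I" "j \<in> I" "k \<in> I" for i j k
  proof -
    have "tri a b i j k = tri a' b i j k + c * tri h b i j k"
      using assms(3) that by (simp add: tri_def algebra_simps)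
    then have "\<bar>tri a b i j k\<bar> \<le> \<bar>tri a' b i j k\<bar> + c * \<bar>tri h b i j k\<bar>"
      using abs_triangle_ineq[of "tri a' b i j k" "c * tri h b i j k"] assms(2) by (simp add: abs_mult)
    then have "t i * t j * t k * \<bar>tri a b i j k\<bar> \<le> t i * t j * t k * (\<bar>tri a' b i j k\<bar> + c * \<bar>tri h b i j k\<bar>)"
      using assms(1) that by (intro mult_left_mono) auto
    then show ?thesis by (simp add: algebra_simps)
  qed
  then have "triangle_sum I t a b \<le> (\<Sum>i\<in>I. \<Sum>j\<in>I. \<Sum>k\<in>I.
      t i * t j * t k * \<bar>tri a' b i j k\<bar> + c * (t i * t j * t k * \<bar>tri h b i j k\<bar>))"
    unfolding triangle_sum_def by (intro sum_mono)
  then show ?thesis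
    by (simp add: triangle_sum_def sum.distrib sum_distrib_left)
qed

text \<open>Distance sums stand on the larger side, so equality is required here. The hypothesis is
  the last fact supplied by the \<open>step\<close> case of
  \<open>finite_levels_induct\<close>.\<close>

lemma distance_sum_add:
  assumes "\<And>i j. i \<in> I \<Longrightarrow> j \<in> I \<Longrightarrow> \<bar>a i - a j\<bar> = \<bar>b i - b j\<bar> + c * \<bar>h i - h j\<bar>"
  shows "distance_sum I t a = distance_sum I t b + c * distance_sum I t h"
  by (simp add: distance_sum_def assms sum_distrib_left sum.distrib distrib_left mult_ac
      cong: sum.cong)

lemma distance_sum_nonneg:
  assumes "\<And>i. i \<in> I \<Longrightarrow> 0 \<le> t i"
  shows "0 \<le> distance_sum I t a"
  unfolding distance_sum_def using assms by (intro sum_nonneg mult_nonneg_nonneg) auto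

text \<open>All points \<open>(a i, b i)\<close> are corners of the unit square, so only the total
  weights \<open>p r s\<close> of the four corners matter and the claim becomes a polynomial
  inequality in them.\<close>

lemma triangle_sum_indicator_le:
  assumes "finite I" "\<And>i. a i \<in> {0, 1}" "\<And>i. b i \<in> {0, 1}"
  shows "2 * triangle_sum I t a b * sum t I \<le> 3 * distance_sum I t a * distance_sum I t b"
proof -
  define p where "p r s = (\<Sum>i | i \<in> I \<and> a i = r \<and> b i = s. t i)" for r s
  define S where "S F = p 0 0 * F 0 0 + p 0 1 * F 0 1 + p 1 0 * F 1 0 + p 1 1 * F 1 1"
    for F :: "real \<Rightarrow> real \<Rightarrow> real"
  have split: "(\<Sum>i\<in>I. t i * F (a i) (b i)) = S F" for F
  proof -
    have "t i * F (a i) (b i) = (if a i = 0 \<and> b i = 0 then t i else 0) * F 0 0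
        + (if a i = 0 \<and> b i = 1 then t i else 0) * F 0 1
        + (if a i = 1 \<and> b i = 0 then t i else 0) * F 1 0
        + (if a i = 1 \<and> b i = 1 then t i else 0) * F 1 1" for i
      using assms(2,3)[of i] by auto
    moreover have "(\<Sum>i\<in>I. (if a i = r \<and> b i = s then t i else 0)) = p r s" for r s
      unfolding p_def using assms(1) by (simp add: sum.inter_filter)
    ultimately show ?thesis
      by (simp add: S_def sum.distrib flip: sum_distrib_right)
  qed
  have "triangle_sum I t a b = (\<Sum>i\<in>I. t i * (\<Sum>j\<in>I. t j * (\<Sum>k\<in>I. t k *
      \<bar>(a i - a k) * (b j - b k) - (a j - a k) * (b i - b k)\<bar>)))"
    by (simp add: triangle_sum_def tri_def sum_distrib_left mult_ac)
  also have "\<dots> = S (\<lambda>x x'. S (\<lambda>y y'. S (\<lambda>z z'. \<bar>(x - z) * (y' - z') - (y - z) * (x' - z')\<bar>)))"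
    by (simp only: split[of "\<lambda>z z'. \<bar>(x - z) * (y' - z') - (y - z) * (x' - z')\<bar>" for x x' y y']
        split[of "\<lambda>y y'. S (\<lambda>z z'. \<bar>(x - z) * (y' - z') - (y - z) * (x' - z')\<bar>)" for x x']
        split[of "\<lambda>x x'. S (\<lambda>y y'. S (\<lambda>z z'. \<bar>(x - z) * (y' - z') - (y - z) * (x' - z')\<bar>))"])
  \<comment> \<open>Any three distinct corners give \<open>tri\<close> the absolute value 1, and
    each such triple occurs in six orders.\<close>
  finally have X: "triangle_sum I t a b = 6 * (p 0 0 * p 0 1 * p 1 0 + p 0 0 * p 0 1 * p 1 1
      + p 0 0 * p 1 0 * p 1 1 + p 0 1 * p 1 0 * p 1 1)"
    by (simp add: S_def algebra_simps)
  have "distance_sum I t a = (\<Sum>i\<in>I. t i * (\<Sum>j\<in>I. t j * \<bar>a i - a j\<bar>))"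
    by (simp add: distance_sum_def sum_distrib_left mult_ac)
  also have "\<dots> = S (\<lambda>x x'. S (\<lambda>y y'. \<bar>x - y\<bar>))"
    by (simp only: split[of "\<lambda>y y'. \<bar>x - y\<bar>" for x] split[of "\<lambda>x x'. S (\<lambda>y y'. \<bar>x - y\<bar>)"])
  finally have Y: "distance_sum I t a = 2 * (p 0 0 + p 0 1) * (p 1 0 + p 1 1)"
    by (simp add: S_def algebra_simps)
  have "distance_sum I t b = (\<Sum>i\<in>I. t i * (\<Sum>j\<in>I. t j * \<bar>b i - b j\<bar>))"
    by (simp add: distance_sum_def sum_distrib_left mult_ac)
  also have "\<dots> = S (\<lambda>x x'. S (\<lambda>y y'. \<bar>x' - y'\<bar>))"
    by (simp only: split[of "\<lambda>y y'. \<bar>x' - y'\<bar>" for x'] split[of "\<lambda>x x'. S (\<lambda>y y'. \<bar>x' - y'\<bar>)"])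
  finally have Z: "distance_sum I t b = 2 * (p 0 0 + p 1 0) * (p 0 1 + p 1 1)"
    by (simp add: S_def algebra_simps)
  have T: "sum t I = p 0 0 + p 0 1 + p 1 0 + p 1 1"
    using split[of "\<lambda>_ _. 1"] by (simp add: S_def)
  have "3 * distance_sum I t a * distance_sum I t b - 2 * triangle_sum I t a b * sum t I
      = 12 * (p 0 0 * p 1 1 - p 0 1 * p 1 0)\<^sup>2"
    unfolding X Y Z T by algebra
  moreover have "0 \<le> 12 * (p 0 0 * p 1 1 - p 0 1 * p 1 0)\<^sup>2" by simp
  ultimately show ?thesis by linarith
qed

text \<open>The sums run over ordered triples and ordered pairs, counting each triangle six times
  and each pair twice; clearing the denominators 6 and 2 * 2 produces the constants 2 and 3.\<close>

lemma triangle_sum_le: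
  assumes "finite I" and t: "\<And>i. i \<in> I \<Longrightarrow> 0 \<le> t i"
  shows "2 * triangle_sum I t a b * sum t I \<le> 3 * distance_sum I t a * distance_sum I t b"
proof -
  have extend: "2 * triangle_sum I t a b * sum t I \<le> 3 * distance_sum I t a * distance_sum I t b"
    if ind: "\<And>a. (\<And>i. a i \<in> {0, 1}) \<Longrightarrow>
      2 * triangle_sum I t a b * sum t I \<le> 3 * distance_sum I t a * distance_sum I t b" for a b
    using \<open>finite I\<close>
  proof (induction a rule: finite_levels_induct)
    case (const a c)
    then have "triangle_sum I t a b = 0" by (simp add: triangle_sum_def tri_def)
    then show ?case using distance_sum_nonneg[of I t] t by simp
  next
    case (indicator a)
    then show ?case by (rule ind)
  next
    case (step a a' c h)
    have "triangle_sum I t a b * sum t I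
        \<le> (triangle_sum I t a' b + c * triangle_sum I t h b) * sum t I"
      using step t by (intro mult_right_mono triangle_sum_add_le sum_nonneg)
    then have "2 * triangle_sum I t a b * sum t I
        \<le> 2 * triangle_sum I t a' b * sum t I + c * (2 * triangle_sum I t h b * sum t I)"
      by (simp add: algebra_simps)
    also have "\<dots> \<le> 3 * distance_sum I t a' * distance_sum I t b
        + c * (3 * distance_sum I t h * distance_sum I t b)"
      using step by (intro add_mono mult_left_mono)
    also have "\<dots> = 3 * distance_sum I t a * distance_sum I t b"
    proof -
      have "distance_sum I t a = distance_sum I t a' + c * distance_sum I t h"
        by (rule distance_sum_add) (rule step(5))
      then show ?thesis by (simp add: algebra_simps)
    qed
    finally show ?case .
  qed
  \<comment> \<open>First \<open>a\<close> is reduced to indicators; for each such \<open>a\<close>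
    the roles are exchanged by symmetry, and \<open>b\<close> is reduced in the same way.\<close>
  show ?thesis
  proof (rule extend)
    fix a :: "'a \<Rightarrow> real" assume a: "\<And>i. a i \<in> {0, 1}"
    have "2 * triangle_sum I t b a * sum t I \<le> 3 * distance_sum I t b * distance_sum I t a"
      by (rule extend) (rule triangle_sum_indicator_le[OF \<open>finite I\<close> _ a])
    then show "2 * triangle_sum I t a b * sum t I \<le> 3 * distance_sum I t a * distance_sum I t b"
      by (simp add: triangle_sum_commute mult_ac)
  qed
qed

section \<open>From planar points to determinants of vectors\<close>

text \<open>The triple sum contains the determinants with rows (\<open>\<alpha> i\<close>,
  \<open>\<beta> i\<close>, \<open>t i\<close>). Dividing each row by its positive last entry turns
  it into a point of the plane with weight \<open>t i\<close>.\<close>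

lemma det_sum_le_pos:
  fixes \<alpha> \<beta> t :: "'i \<Rightarrow> real"
  assumes "finite I" and t: "\<And>i. i \<in> I \<Longrightarrow> 0 < t i"
  shows "2 * (\<Sum>i\<in>I. \<Sum>j\<in>I. \<Sum>k\<in>I. \<bar>\<alpha> i * (\<beta> j * t k - t j * \<beta> k) - \<beta> i * (\<alpha> j * t k - t j * \<alpha> k)
            + t i * (\<alpha> j * \<beta> k - \<beta> j * \<alpha> k)\<bar>) * (\<Sum>i\<in>I. t i)
    \<le> 3 * (\<Sum>i\<in>I. \<Sum>j\<in>I. \<bar>\<alpha> i * t j - t i * \<alpha> j\<bar>) * (\<Sum>i\<in>I. \<Sum>j\<in>I. \<bar>\<beta> i * t j - t i * \<beta> j\<bar>)"
proof -
  define a where "a i = \<alpha> i / t i" for i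
  define b where "b i = \<beta> i / t i" for i
  have \<alpha>: "\<alpha> i = t i * a i" and \<beta>: "\<beta> i = t i * b i" if "i \<in> I" for i
    using t[OF that] by (simp_all add: a_def b_def)
  have pos: "0 \<le> t i" if "i \<in> I" for i using t[OF that] by simp
  have 1: "\<bar>t i * c i * t j - t i * (t j * c j)\<bar> = t i * t j * \<bar>c i - c j\<bar>"
    if "i \<in> I" "j \<in> I" for i j and c :: "'i \<Rightarrow> real"
  proof -
    have "t i * c i * t j - t i * (t j * c j) = (t i * t j) * (c i - c j)" by (simp add: algebra_simps)
    then show ?thesis using pos[OF that(1)] pos[OF that(2)] by (simp add: abs_mult)
  qed
  have 2: "\<bar>\<alpha> i * (\<beta> j * t k - t j * \<beta> k) - \<beta> i * (\<alpha> j * t k - t j * \<alpha> k)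
            + t i * (\<alpha> j * \<beta> k - \<beta> j * \<alpha> k)\<bar> = t i * t j * t k * \<bar>tri a b i j k\<bar>"
    if "i \<in> I" "j \<in> I" "k \<in> I" for i j k
  proof -
    have "\<alpha> i * (\<beta> j * t k - t j * \<beta> k) - \<beta> i * (\<alpha> j * t k - t j * \<alpha> k)
            + t i * (\<alpha> j * \<beta> k - \<beta> j * \<alpha> k) = (t i * t j * t k) * tri a b i j k"
      using that by (simp add: \<alpha> \<beta> tri_def algebra_simps)
    then show ?thesis using pos that by (simp add: abs_mult)
  qed
  have "(\<Sum>i\<in>I. \<Sum>j\<in>I. \<bar>\<alpha> i * t j - t i * \<alpha> j\<bar>) = distance_sum I t a"
    unfolding distance_sum_def by (intro sum.cong refl) (simp add: \<alpha> 1)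
  moreover have "(\<Sum>i\<in>I. \<Sum>j\<in>I. \<bar>\<beta> i * t j - t i * \<beta> j\<bar>) = distance_sum I t b"
    unfolding distance_sum_def by (intro sum.cong refl) (simp add: \<beta> 1)
  moreover have "(\<Sum>i\<in>I. \<Sum>j\<in>I. \<Sum>k\<in>I. \<bar>\<alpha> i * (\<beta> j * t k - t j * \<beta> k) - \<beta> i * (\<alpha> j * t k - t j * \<alpha> k)
            + t i * (\<alpha> j * \<beta> k - \<beta> j * \<alpha> k)\<bar>) = triangle_sum I t a b"
    unfolding triangle_sum_def by (intro sum.cong refl 2)
  ultimately show ?thesis
    using triangle_sum_le[OF assms(1) pos] by simp
qed

lemma det_sum_le:
  fixes \<alpha> \<beta> t :: "'i \<Rightarrow> real"
  assumes "finite I"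
  shows "2 * (\<Sum>i\<in>I. \<Sum>j\<in>I. \<Sum>k\<in>I. \<bar>\<alpha> i * (\<beta> j * t k - t j * \<beta> k) - \<beta> i * (\<alpha> j * t k - t j * \<alpha> k)
            + t i * (\<alpha> j * \<beta> k - \<beta> j * \<alpha> k)\<bar>) * (\<Sum>i\<in>I. \<bar>t i\<bar>)
    \<le> 3 * (\<Sum>i\<in>I. \<Sum>j\<in>I. \<bar>\<alpha> i * t j - t i * \<alpha> j\<bar>) * (\<Sum>i\<in>I. \<Sum>j\<in>I. \<bar>\<beta> i * t j - t i * \<beta> j\<bar>)"
    (is "?L \<alpha> \<beta> t \<le> ?R \<alpha> \<beta> t")
proof -
  have nonneg: "?L \<alpha> \<beta> t \<le> ?R \<alpha> \<beta> t" if "\<And>i. 0 \<le> t i" for \<alpha> \<beta> t :: "'i \<Rightarrow> real"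
  proof (rule tendsto_le)
    \<comment> \<open>Shifting every \<open>t i\<close> by \<open>e > 0\<close> makes the division by \<open>t i\<close> legitimate.\<close>
    show "((\<lambda>e. ?L \<alpha> \<beta> (\<lambda>i. t i + e)) \<longlongrightarrow> ?L \<alpha> \<beta> t) (at_right 0)"
      by (auto intro!: tendsto_eq_intros)
    show "((\<lambda>e. ?R \<alpha> \<beta> (\<lambda>i. t i + e)) \<longlongrightarrow> ?R \<alpha> \<beta> t) (at_right 0)"
      by (auto intro!: tendsto_eq_intros)
    have pos: "\<And>i. 0 < t i + e" if "0 < e" for e
      using \<open>\<And>i. 0 \<le> t i\<close> that by (metis add_nonneg_pos)
    have "?L \<alpha> \<beta> (\<lambda>i. t i + e) \<le> ?R \<alpha> \<beta> (\<lambda>i. t i + e)" if "0 < e" for e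
      using det_sum_le_pos[OF assms, of "\<lambda>i. t i + e" \<alpha> \<beta>] pos[OF that] by (simp add: less_imp_le)
    then show "\<forall>\<^sub>F e in at_right 0. ?L \<alpha> \<beta> (\<lambda>i. t i + e) \<le> ?R \<alpha> \<beta> (\<lambda>i. t i + e)"
      by (auto simp: eventually_at_right_less intro: eventually_at_rightI[of 0 1])
  qed simp
  \<comment> \<open>Negating a vector leaves all absolute determinants unchanged, so every
    \<open>t i\<close> may be made nonnegative.\<close>
  define s where "s i = (if 0 \<le> t i then 1 else -1 :: real)" for i
  have s: "\<bar>s i\<bar> = 1" for i by (simp add: s_def)
  have 3: "\<bar>s i * \<alpha> i * (s j * \<beta> j * (s k * t k) - s j * t j * (s k * \<beta> k)) - s i * \<beta> i * (s j * \<alpha> j * (s k * t k) - s j * t j * (s k * \<alpha> k))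
            + s i * t i * (s j * \<alpha> j * (s k * \<beta> k) - s j * \<beta> j * (s k * \<alpha> k))\<bar>
     = \<bar>\<alpha> i * (\<beta> j * t k - t j * \<beta> k) - \<beta> i * (\<alpha> j * t k - t j * \<alpha> k)
            + t i * (\<alpha> j * \<beta> k - \<beta> j * \<alpha> k)\<bar>" (is "\<bar>?l\<bar> = \<bar>?r\<bar>") for i j k
  proof -
    have "?l = (s i * s j * s k) * ?r" by (simp add: algebra_simps)
    then show ?thesis by (simp add: abs_mult s)
  qed
  have 2: "\<bar>s i * \<gamma> i * (s j * t j) - s i * t i * (s j * \<gamma> j)\<bar> = \<bar>\<gamma> i * t j - t i * \<gamma> j\<bar>" for i j and \<gamma> :: "'i \<Rightarrow> real"
  proof -
    have "s i * \<gamma> i * (s j * t j) - s i * t i * (s j * \<gamma> j) = (s i * s j) * (\<gamma> i * t j - t i * \<gamma> j)"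
      by (simp add: algebra_simps)
    then show ?thesis by (simp add: abs_mult s)
  qed
  have "?L (\<lambda>i. s i * \<alpha> i) (\<lambda>i. s i * \<beta> i) (\<lambda>i. s i * t i) \<le> ?R (\<lambda>i. s i * \<alpha> i) (\<lambda>i. s i * \<beta> i) (\<lambda>i. s i * t i)"
    by (rule nonneg) (simp add: s_def)
  then show ?thesis by (simp only: 2 3) (simp add: abs_mult s)
qed

definition triple :: "real^3 \<Rightarrow> real^3 \<Rightarrow> real^3 \<Rightarrow> real" where
  "triple x y z = x \<bullet> cross3 y z"

text \<open>If \<open>u\<close> and \<open>v\<close> are linearly dependent, the left side vanishes.
  Otherwise the vectors are written in a basis containing \<open>u\<close> and \<open>v\<close>,
  where the determinants take the form of \<open>det_sum_le\<close>.\<close>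

lemma triple_sum_le:
  fixes x :: "'i \<Rightarrow> real^3"
  assumes "finite I"
  shows "2 * (\<Sum>i\<in>I. \<Sum>j\<in>I. \<Sum>k\<in>I. \<bar>triple (x i) (x j) (x k)\<bar>) * (\<Sum>i\<in>I. \<bar>triple (x i) u v\<bar>)
    \<le> 3 * (\<Sum>i\<in>I. \<Sum>j\<in>I. \<bar>triple (x i) (x j) u\<bar>) * (\<Sum>i\<in>I. \<Sum>j\<in>I. \<bar>triple (x i) (x j) v\<bar>)"
proof (cases "cross3 u v = 0")
  case True
  then show ?thesis by (simp add: triple_def sum_nonneg)
next
  case False
  \<comment> \<open>The vector \<open>w\<close> completes \<open>u\<close>, \<open>v\<close> to a
    basis, because the determinant \<open>D\<close> equals the squared norm of \<open>w\<close>. The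
    coordinates below come from Cramer's rule.\<close>
  define w where "w = cross3 u v"
  define D where "D = triple u v w"
  have "D = w \<bullet> w"
    unfolding D_def w_def triple_def by (simp add: cross3_simps)
  then have "D > 0" using False by (simp add: w_def)
  define \<alpha> where "\<alpha> i = triple (x i) v w / D" for i
  define \<beta> where "\<beta> i = triple u (x i) w / D" for i
  define t where "t i = triple u v (x i) / D" for i
  have "D *\<^sub>R y = triple y v w *\<^sub>R u + triple u y w *\<^sub>R v + triple u v y *\<^sub>R w" for y
    unfolding D_def triple_def by (simp add: vec_eq_iff forall_3 cross3_simps)
  from this[of "x i" for i] have x: "x i = \<alpha> i *\<^sub>R u + \<beta> i *\<^sub>R v + t i *\<^sub>R w" for i
    using \<open>D > 0\<close> unfolding \<alpha>_def \<beta>_def t_def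
    by (metis (no_types, lifting) divide_inverse_commute less_irrefl scaleR_left.add scaleR_right_distrib scaleR_scaleR
        scaleR_one left_inverse)
  have 3: "triple (x i) (x j) (x k) = D * (\<alpha> i * (\<beta> j * t k - t j * \<beta> k) - \<beta> i * (\<alpha> j * t k - t j * \<alpha> k)
            + t i * (\<alpha> j * \<beta> k - \<beta> j * \<alpha> k))" for i j k
    unfolding x D_def triple_def by (simp add: cross3_simps)
  have 2: "triple (x i) (x j) u = D * (\<beta> i * t j - t i * \<beta> j)"
    "triple (x i) (x j) v = - D * (\<alpha> i * t j - t i * \<alpha> j)" for i j
    unfolding x D_def triple_def by (simp_all add: cross3_simps)
  have 1: "triple (x i) u v = D * t i" for i
    unfolding x D_def triple_def by (simp add: cross3_simps)
  \<comment> \<open>Each product on either side has two determinant factors, so both sides scale by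
    \<open>D * D\<close>.\<close>
  have "D * D * (2 * (\<Sum>i\<in>I. \<Sum>j\<in>I. \<Sum>k\<in>I. \<bar>\<alpha> i * (\<beta> j * t k - t j * \<beta> k) - \<beta> i * (\<alpha> j * t k - t j * \<alpha> k)
            + t i * (\<alpha> j * \<beta> k - \<beta> j * \<alpha> k)\<bar>) * (\<Sum>i\<in>I. \<bar>t i\<bar>))
    \<le> D * D * (3 * (\<Sum>i\<in>I. \<Sum>j\<in>I. \<bar>\<alpha> i * t j - t i * \<alpha> j\<bar>) * (\<Sum>i\<in>I. \<Sum>j\<in>I. \<bar>\<beta> i * t j - t i * \<beta> j\<bar>))"
    using \<open>D > 0\<close> by (intro mult_left_mono det_sum_le assms) simp
  then show ?thesis
    using \<open>D > 0\<close> by (simp add: 1 2 3 abs_mult mult_ac flip: sum_distrib_left)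
qed

section \<open>Volumes and projections of sums of segments\<close>

text \<open>All segments start at the origin; translations are left to
  \<open>is_segment_sum\<close>. Taking the first \<open>n\<close> members of a sequence lets
  inductions add one generator at a time.\<close>

definition segment_sum :: "nat \<Rightarrow> (nat \<Rightarrow> 'a::real_vector) \<Rightarrow> 'a set" where
  "segment_sum n x = (\<Sum>i<n. closed_segment 0 (x i))"

lemma segment_sum_0 [simp]: "segment_sum 0 x = {0}"
  by (simp add: segment_sum_def set_zero)

lemma segment_sum_Suc: "segment_sum (Suc n) x = segment_sum n x + closed_segment 0 (x n)"
  by (simp add: segment_sum_def)

lemma compact_set_plus:
  fixes S T :: "'a::real_normed_vector set"
  assumes "compact S" "compact T"
  shows "compact (S + T)"
proof -
  have "S + T = {x + y | x y. x \<in> S \<and> y \<in> T}" by (auto simp: set_plus_def)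
  then show ?thesis using compact_sums[OF assms] by simp
qed

lemma compact_segment_sum: "compact (segment_sum n x)" for x :: "nat \<Rightarrow> 'a::euclidean_space"
  by (induction n) (auto simp: segment_sum_Suc intro: compact_set_plus)

lemma convex_segment_sum: "convex (segment_sum n x)" for x :: "nat \<Rightarrow> 'a::euclidean_space"
  by (induction n) (auto simp: segment_sum_Suc intro: convex_set_plus)

lemma linear_image_set_plus:
  assumes "linear f"
  shows "f ` (S + T) = f ` S + f ` T"
proof (intro equalityI subsetI)
  fix z assume "z \<in> f ` S + f ` T"
  then obtain x y where "x \<in> S" "y \<in> T" "z = f x + f y" by (auto elim!: set_plus_elim)
  then show "z \<in> f ` (S + T)" by (simp add: set_plus_intro flip: linear_add[OF assms])
qed (use linear_add[OF assms] in \<open>auto intro!: set_plus_intro elim!: set_plus_elim\<close>)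

lemma linear_image_segment_sum:
  assumes "linear f"
  shows "f ` segment_sum n x = segment_sum n (\<lambda>i. f (x i))"
proof (induction n)
  case (Suc n)
  then show ?case
    using linear_0[OF assms]
    by (simp add: segment_sum_Suc linear_image_set_plus[OF assms] flip: closed_segment_linear_image[OF assms])
qed (simp add: linear_0[OF assms])

lemma sum2_lessThan_Suc:
  fixes f :: "nat \<Rightarrow> nat \<Rightarrow> real"
  assumes "\<And>i j. f i j = f j i" "f n n = 0"
  shows "(\<Sum>i<Suc n. \<Sum>j<Suc n. f i j) = (\<Sum>i<n. \<Sum>j<n. f i j) + 2 * (\<Sum>i<n. f i n)"
proof -
  have "(\<Sum>j<n. f n j) = (\<Sum>i<n. f i n)" by (rule sum.cong[OF refl]) (rule assms(1))
  then show ?thesis using assms(2) by (simp add: sum.distrib)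
qed

text \<open>Triples containing the new index \<open>n\<close> twice contribute nothing, and by
  symmetry its three possible positions contribute equally.\<close>

lemma sum3_lessThan_Suc:
  fixes f :: "nat \<Rightarrow> nat \<Rightarrow> nat \<Rightarrow> real"
  assumes "\<And>i j k. f i j k = f j i k" "\<And>i j k. f i j k = f i k j" "\<And>i j. f i j j = 0"
  shows "(\<Sum>i<Suc n. \<Sum>j<Suc n. \<Sum>k<Suc n. f i j k)
    = (\<Sum>i<n. \<Sum>j<n. \<Sum>k<n. f i j k) + 3 * (\<Sum>i<n. \<Sum>j<n. f i j n)"
proof -
  have "(\<Sum>j<n. \<Sum>k<n. f n j k) = (\<Sum>i<n. \<Sum>j<n. f i j n)"
    "(\<Sum>i<n. \<Sum>k<n. f i n k) = (\<Sum>i<n. \<Sum>j<n. f i j n)"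
    by (intro sum.cong refl; metis assms(1,2))+
  moreover have "f n n k = 0" "f k n n = 0" "f n k n = 0" for k
    using assms by metis+
  ultimately show ?thesis by (simp only: sum.lessThan_Suc sum.distrib) simp
qed

lemma Icc_plus_Icc:
  fixes a b c d :: real
  assumes "a \<le> b" "c \<le> d"
  shows "{a..b} + {c..d} = {a + c..b + d}"
proof -
  have "x \<in> {a..b} + {c..d}" if "a + c \<le> x" "x \<le> b + d" for x
  proof -
    \<comment> \<open>The first summand is chosen as large as possible, which makes the second as
      small as possible.\<close>
    have "min b (x - c) \<in> {a..b}" "x - min b (x - c) \<in> {c..d}" using assms that by auto
    then have "min b (x - c) + (x - min b (x - c)) \<in> {a..b} + {c..d}" by (rule set_plus_intro)
    then show ?thesis by simp
  qed
  then show ?thesis by (auto elim!: set_plus_elim)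
qed

lemma length_segment_sum: "measure lborel (segment_sum n x) = (\<Sum>i<n. \<bar>x i\<bar>)" for x :: "nat \<Rightarrow> real"
proof -
  have "\<exists>l. segment_sum n x = {l..l + (\<Sum>i<n. \<bar>x i\<bar>)}"
  proof (induction n)
    case 0
    then show ?case by (auto intro!: exI[of _ 0])
  next
    case (Suc n)
    then obtain l where l: "segment_sum n x = {l..l + (\<Sum>i<n. \<bar>x i\<bar>)}" by blast
    have "closed_segment 0 (x n) = {min 0 (x n)..min 0 (x n) + \<bar>x n\<bar>}"
      by (auto simp: closed_segment_eq_real_ivl)
    then have "segment_sum (Suc n) x = {l + min 0 (x n)..(l + (\<Sum>i<n. \<bar>x i\<bar>)) + (min 0 (x n) + \<bar>x n\<bar>)}"
      unfolding segment_sum_Suc l by (simp only:) (rule Icc_plus_Icc; simp add: sum_nonneg)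
    then show ?case by (auto simp: algebra_simps)
  qed
  then show ?thesis by (auto simp: sum_nonneg)
qed

section \<open>Cavalieri's principle in rotated coordinates\<close>

lemma cavalieri_vertical:
  fixes K :: "('a::euclidean_space \<times> real) set"
  assumes "compact K" "convex K" "0 \<le> s"
  shows "measure lborel (K + closed_segment 0 (0, s)) = measure lborel K + s * measure lborel (fst ` K)"
proof -
  let ?L = "K + closed_segment 0 (0, s)"
  have "closed_segment (0, 0) (0, s) = (\<lambda>r. (0 :: 'a, r)) ` closed_segment 0 s"
    by (rule closed_segment_linear_image) (auto intro!: linearI)
  then have seg: "closed_segment 0 (0, s) = (\<lambda>r. (0 :: 'a, r)) ` {0..s}"
    using \<open>0 \<le> s\<close> by (simp add: closed_segment_eq_real_ivl zero_prod_def)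
  have compL: "compact ?L" using assms by (intro compact_set_plus) auto
  have compF: "compact (fst ` K)" using assms by (intro compact_continuous_image continuous_intros) auto
  have fiber: "emeasure lborel (Pair x -` ?L) = emeasure lborel (Pair x -` K) + ennreal s * indicator (fst ` K) x" for x
  proof (cases "x \<in> fst ` K")
    case True
    have "Pair x -` K = snd ` (K \<inter> ({x} \<times> UNIV))" by force
    moreover have "compact (K \<inter> ({x} \<times> UNIV))"
      using assms by (intro compact_Int_closed closed_Times) auto
    moreover have "convex (K \<inter> ({x} \<times> UNIV))"
      using assms by (intro convex_Int convex_Times) auto
    ultimately have "compact (Pair x -` K)" "convex (Pair x -` K)"
      by (auto intro!: compact_continuous_image continuous_intros convex_linear_image linear_snd)
    then have "connected (Pair x -` K) \<and> compact (Pair x -` K)"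
      by (simp add: convex_connected)
    then obtain a b where ab: "Pair x -` K = {a..b}"
      unfolding connected_compact_interval_1 by auto
    obtain r where "(x, r) \<in> K" using True by force
    then have "r \<in> {a..b}" by (simp flip: ab)
    then have "a \<le> b" by simp
    have "Pair x -` ?L = Pair x -` K + {0..s}"
      unfolding seg by (force simp: set_plus_def)
    also have "\<dots> = {a..b + s}" using Icc_plus_Icc[of a b 0 s] \<open>a \<le> b\<close> \<open>0 \<le> s\<close> ab by simp
    finally show ?thesis
      using ab \<open>a \<le> b\<close> \<open>0 \<le> s\<close> True by (simp flip: ennreal_plus)
  next
    case False
    then have "Pair x -` K = {}" "Pair x -` ?L = {}"
      unfolding seg by (force simp: set_plus_def)+
    with False show ?thesis by simp
  qed
  have sets: "K \<in> sets (lborel \<Otimes>\<^sub>M lborel)" "?L \<in> sets (lborel \<Otimes>\<^sub>M lborel)"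
    unfolding lborel_prod using assms compL by (simp_all add: borel_compact)
  have meas: "fst ` K \<in> sets lborel"
    using compF by (simp add: borel_compact)
  note m = lborel.measurable_emeasure_Pair[OF sets(1)]
  have "emeasure lborel ?L = (\<integral>\<^sup>+x. emeasure lborel (Pair x -` ?L) \<partial>lborel)"
    using lborel.emeasure_pair_measure_alt[OF sets(2)] by (simp add: lborel_prod)
  also have "\<dots> = (\<integral>\<^sup>+x. emeasure lborel (Pair x -` K) \<partial>lborel) + ennreal s * emeasure lborel (fst ` K)"
    unfolding fiber using m meas by (subst nn_integral_add) (auto simp: nn_integral_cmult_indicator)
  also have "(\<integral>\<^sup>+x. emeasure lborel (Pair x -` K) \<partial>lborel) = emeasure lborel K"
    using lborel.emeasure_pair_measure_alt[OF sets(1)] by (simp add: lborel_prod)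
  finally have eq: "emeasure lborel ?L = emeasure lborel K + ennreal s * emeasure lborel (fst ` K)" .
  have fin: "emeasure lborel S = ennreal (measure lborel S)" if "compact S" for S :: "'b::euclidean_space set"
    using emeasure_bounded_finite[OF compact_imp_bounded[OF that]]
    by (simp add: emeasure_eq_ennreal_measure less_top)
  from eq show ?thesis
    using \<open>0 \<le> s\<close> by (simp add: fin assms compL compF flip: ennreal_mult ennreal_plus)
qed

text \<open>Such a map pulls boxes back to boxes with the same side lengths, and boxes determine
  Lebesgue measure. This identifies the measure on a product with that on a vector type.\<close>

lemma distr_lborel_orthogonal_Basis:
  fixes f :: "'a::euclidean_space \<Rightarrow> 'b::euclidean_space"
  assumes f: "orthogonal_transformation f" and Basis: "f ` Basis = Basis"
  shows "distr lborel borel f = lborel"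
proof (rule lborel_eqI[symmetric])
  have lin: "linear f" and inner: "f v \<bullet> f w = v \<bullet> w" for v w
    using f by (auto simp: orthogonal_transformation_def)
  have inj: "inj_on f Basis"
    using inner inj_on_def by (metis inner_Basis inner_same_Basis zero_neq_one)
  have [measurable]: "f \<in> borel \<rightarrow>\<^sub>M borel"
    using lin by (intro borel_measurable_continuous_onI linear_continuous_on) (simp add: linear_conv_bounded_linear)
  fix l u :: 'b assume le: "\<And>b. b \<in> Basis \<Longrightarrow> l \<bullet> b \<le> u \<bullet> b"
  \<comment> \<open>\<open>p\<close> acts as the inverse of \<open>f\<close>: it sends the corners
    of a box to the corners of its preimage.\<close>
  define p where "p c = (\<Sum>b\<in>Basis. (c \<bullet> f b) *\<^sub>R b)" for c
  have p: "p c \<bullet> b = c \<bullet> f b" if "b \<in> Basis" for c b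
    using that by (simp add: p_def inner_sum_left_Basis)
  have "f -` box l u = box (p l) (p u)"
    unfolding box_def by (subst Basis[symmetric]) (auto simp: p inner)
  moreover have "p l \<bullet> b \<le> p u \<bullet> b" if "b \<in> Basis" for b
    using le that Basis by (auto simp: p)
  ultimately have "emeasure (distr lborel borel f) (box l u) = (\<Prod>b\<in>Basis. (p u - p l) \<bullet> b)"
    by (simp add: emeasure_distr)
  also have "(\<Prod>b\<in>Basis. (p u - p l) \<bullet> b) = (\<Prod>b\<in>Basis. (u - l) \<bullet> f b)"
    by (intro prod.cong) (auto simp: inner_diff_left p)
  also have "\<dots> = (\<Prod>b\<in>Basis. (u - l) \<bullet> b)"
    using inj by (subst Basis[symmetric], subst prod.reindex) simp_all
  finally show "emeasure (distr lborel borel f) (box l u) = (\<Prod>b\<in>Basis. (u - l) \<bullet> b)" .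
qed simp

text \<open>The sort \<open>wellorder\<close> is inherited from the library's \<open>measure_orthogonal_image\<close>.\<close>

definition frame :: "('a::euclidean_space \<times> real \<Rightarrow> (real, 'n::{finite,wellorder}) vec) \<Rightarrow> bool" where
  "frame G \<longleftrightarrow> orthogonal_transformation G \<and> surj G \<and>
     (\<forall>S. compact S \<longrightarrow> measure lebesgue (G ` S) = measure lborel S)"

lemma frame_linear: "frame G \<Longrightarrow> linear G"
  unfolding frame_def orthogonal_transformation_def by blast

lemma frame_inner: "frame G \<Longrightarrow> G v \<bullet> G w = v \<bullet> w"
  unfolding frame_def orthogonal_transformation_def by blast

text \<open>A rotation after \<open>f\<close> turns the vertical axis into the direction of
  \<open>v\<close>, so that \<open>cavalieri_vertical\<close> applies to segments parallel to
  \<open>v\<close>.\<close>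

lemma frame_exists:
  fixes f :: "'a::euclidean_space \<times> real \<Rightarrow> (real, 'n::{finite,wellorder}) vec"
  assumes f: "orthogonal_transformation f" and Basis: "f ` Basis = Basis"
  obtains G :: "'a \<times> real \<Rightarrow> (real, 'n::{finite,wellorder}) vec" where "frame G" "G (0, norm v) = v"
proof -
  have lin: "linear f" and norm: "\<And>v. norm (f v) = norm v"
    using f unfolding orthogonal_transformation by blast+
  have "norm (f (0, 1)) = 1" by (simp add: norm norm_Pair)
  \<comment> \<open>For \<open>v = 0\<close> any unit vector would do, since the vertical vector of
    length 0 is mapped to 0 anyway.\<close>
  define e :: "(real, 'n) vec" where "e = (if v = 0 then f (0, 1) else v /\<^sub>R norm v)"
  have "norm e = 1" by (simp add: e_def \<open>norm (f (0, 1)) = 1\<close>)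
  obtain R where R: "orthogonal_transformation R" "R (f (0, 1)) = e"
    using orthogonal_transformation_exists_1[OF \<open>norm (f (0, 1)) = 1\<close> \<open>norm e = 1\<close>] .
  have linR: "linear R" using R(1) by (simp add: orthogonal_transformation_def)
  define G where "G = R \<circ> f"
  have G: "orthogonal_transformation G"
    unfolding G_def using R(1) f by (auto simp: orthogonal_transformation_def intro: linear_compose)
  have "span (Basis :: (real, 'n) vec set) \<subseteq> range f"
    by (rule span_minimal) (use Basis lin in \<open>auto simp: linear_subspace_image\<close>)
  then have "surj f" by (simp add: top.extremum_unique)
  then have "surj G"
    unfolding G_def using orthogonal_transformation_surj[OF R(1)] by (rule comp_surj)
  moreover have "measure lebesgue (G ` S) = measure lborel S" if "compact S" for S
  proof -
    have "compact (f ` S)"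
      using that lin by (intro compact_continuous_image linear_continuous_on) (auto simp: linear_conv_bounded_linear)
    have [measurable]: "f \<in> borel \<rightarrow>\<^sub>M borel"
      using lin by (intro borel_measurable_continuous_onI linear_continuous_on) (simp add: linear_conv_bounded_linear)
    have "inj f" using lin norm by (metis linear_injective_0 norm_eq_zero)
    have "measure lebesgue (G ` S) = measure lebesgue (f ` S)"
      unfolding G_def image_comp[symmetric]
      using \<open>compact (f ` S)\<close> by (intro measure_orthogonal_image R lmeasurable_compact)
    also have "\<dots> = measure lborel (f ` S)"
      using \<open>compact (f ` S)\<close> by (intro measure_completion) (simp add: borel_compact)
    also have "\<dots> = measure (distr lborel borel f) (f ` S)"
      by (simp add: distr_lborel_orthogonal_Basis[OF f Basis])
    also have "\<dots> = measure lborel S"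
      using \<open>compact (f ` S)\<close> \<open>inj f\<close> by (subst measure_distr) (auto simp: borel_compact inj_vimage_image_eq)
    finally show ?thesis .
  qed
  ultimately have "frame G" unfolding frame_def using G by blast
  moreover have "G (0, norm v) = v"
  proof -
    have "G (0, norm v) = norm v *\<^sub>R G (0, 1)"
      using linear_scale[of G "norm v" "(0, 1)"] G by (simp add: orthogonal_transformation_def)
    then show ?thesis by (simp add: G_def R e_def)
  qed
  ultimately show thesis by (rule that)
qed

lemma frame2_exists:
  obtains G :: "real \<times> real \<Rightarrow> real^2" where "frame G" "G (0, norm v) = v"
proof (rule frame_exists)
  let ?f = "\<lambda>(a :: real, b :: real). vector [a, b] :: real^2"
  show "orthogonal_transformation ?f"
    by (auto simp: orthogonal_transformation_def vec_eq_iff forall_2 inner_vec_def sum_2 intro!: linearI)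
  show "?f ` Basis = Basis"
    by (auto simp: Basis_prod_def Basis_vec_def UNIV_2 axis_def vec_eq_iff forall_2)
qed (use that in blast)

lemma frame3_exists:
  obtains G :: "(real^2) \<times> real \<Rightarrow> real^3" where "frame G" "G (0, norm v) = v"
proof (rule frame_exists)
  let ?f = "\<lambda>(a :: real^2, b :: real). vector [a$1, a$2, b] :: real^3"
  show "orthogonal_transformation ?f"
    by (auto simp: orthogonal_transformation_def vec_eq_iff forall_3 inner_vec_def sum_2 sum_3 intro!: linearI)
  have "?f (axis 1 1, 0) = axis 1 1" "?f (axis 2 1, 0) = axis 2 1" "?f (0, 1) = axis 3 1"
    by (simp_all add: axis_def vec_eq_iff forall_3)
  then have "?f ` {(axis 1 1, 0), (axis 2 1, 0), (0, 1)} = {axis 1 1, axis 2 1, axis 3 1}"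
    by (simp only: image_insert image_empty)
  moreover have "(Basis :: ((real^2) \<times> real) set) = {(axis 1 1, 0), (axis 2 1, 0), (0, 1)}"
    by (auto simp: Basis_prod_def Basis_vec_def UNIV_2)
  moreover have "(Basis :: (real^3) set) = {axis 1 1, axis 2 1, axis 3 1}"
    by (auto simp: Basis_vec_def UNIV_3)
  ultimately show "?f ` Basis = Basis" by simp
qed (use that in blast)

lemma frame_preimages:
  fixes x :: "nat \<Rightarrow> (real, 'n::{finite,wellorder}) vec"
  assumes "frame G" "G p = x n"
  obtains z where "\<And>i. G (z i) = x i" "z n = p"
proof (rule that[of "(inv G \<circ> x)(n := p)"])
  have "surj G" using assms by (simp add: frame_def)
  then show "G (((inv G \<circ> x)(n := p)) i) = x i" for i
    using assms(2) by (simp add: surj_f_inv_f)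
qed simp

text \<open>In frame coordinates the last generator is vertical, and the shadow along it is the sum
  of the segments spanned by the first components.\<close>

lemma measure_segment_sum_Suc:
  assumes G: "frame G" and "y n = (0, s)" "0 \<le> s"
  shows "measure lebesgue (segment_sum (Suc n) (\<lambda>i. G (y i)))
    = measure lebesgue (segment_sum n (\<lambda>i. G (y i))) + s * measure lborel (segment_sum n (\<lambda>i. fst (y i)))"
proof -
  have lin: "linear G" and m: "\<And>S. compact S \<Longrightarrow> measure lebesgue (G ` S) = measure lborel S"
    using G frame_linear unfolding frame_def by blast+
  show ?thesis
    unfolding linear_image_segment_sum[OF lin, symmetric] linear_image_segment_sum[OF linear_fst, symmetric]
    by (simp add: m compact_segment_sum) (simp add: segment_sum_Suc assms cavalieri_vertical compact_segment_sum convex_segment_sum)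
qed

section \<open>Gram determinants and the volume of a sum of segments\<close>

definition cross2 :: "real^2 \<Rightarrow> real^2 \<Rightarrow> real" where
  "cross2 x y = x$1 * y$2 - x$2 * y$1"

text \<open>The squared determinant is a Gram determinant and depends on inner products only. Hence,
  as with \<open>triple_gram\<close> below, its absolute value can be computed in any frame.\<close>

lemma cross2_gram: "(cross2 x y)\<^sup>2 = (x \<bullet> x) * (y \<bullet> y) - (x \<bullet> y)\<^sup>2"
  by (simp add: cross2_def inner_vec_def sum_2) algebra

lemma abs_cross2_frame:
  assumes "frame G" "0 \<le> s"
  shows "\<bar>cross2 (G p) (G (0, s))\<bar> = s * \<bar>fst p\<bar>"
proof -
  have inner: "G v \<bullet> G w = v \<bullet> w" for v w
    using assms(1) by (rule frame_inner)
  have "(cross2 (G p) (G (0, s)))\<^sup>2 = (s * fst p)\<^sup>2"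
    unfolding cross2_gram inner by (cases p) (simp add: power2_eq_square algebra_simps)
  then have "\<bar>cross2 (G p) (G (0, s))\<bar> = \<bar>s * fst p\<bar>" by (simp only: abs_eq_iff power2_eq_iff)
  then show ?thesis using \<open>0 \<le> s\<close> by (simp add: abs_mult)
qed

lemma triple_gram: "(triple x y z)\<^sup>2 = (x \<bullet> x) * (y \<bullet> y) * (z \<bullet> z) + 2 * (x \<bullet> y) * (y \<bullet> z) * (x \<bullet> z)
    - (x \<bullet> x) * (y \<bullet> z)\<^sup>2 - (y \<bullet> y) * (x \<bullet> z)\<^sup>2 - (z \<bullet> z) * (x \<bullet> y)\<^sup>2"
  unfolding triple_def cross3_def inner_vec_def sum_3 inner_real_def vector_3 by algebra

lemma abs_triple_frame:
  assumes "frame G" "0 \<le> s"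
  shows "\<bar>triple (G p) (G q) (G (0, s))\<bar> = s * \<bar>cross2 (fst p) (fst q)\<bar>"
proof -
  have inner: "G v \<bullet> G w = v \<bullet> w" for v w
    using assms(1) by (rule frame_inner)
  have "(triple (G p) (G q) (G (0, s)))\<^sup>2 = s\<^sup>2 * (cross2 (fst p) (fst q))\<^sup>2"
    unfolding triple_gram cross2_gram inner
    by (cases p; cases q) (simp add: power2_eq_square algebra_simps)
  then have "\<bar>triple (G p) (G q) (G (0, s))\<bar> = \<bar>s * cross2 (fst p) (fst q)\<bar>"
    by (simp only: power_mult_distrib[symmetric] abs_eq_iff power2_eq_iff)
  then show ?thesis using \<open>0 \<le> s\<close> by (simp add: abs_mult)
qed

text \<open>Adding \<open>x n\<close> increases the area by its length times the width of the old
  sum transversal to it, which is the sum of the new determinants. Ordered pairs account for the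
  factor 1/2.\<close>

lemma area_segment_sum: "measure lebesgue (segment_sum n x) = (\<Sum>i<n. \<Sum>j<n. \<bar>cross2 (x i) (x j)\<bar>) / 2"
proof (induction n)
  case (Suc n)
  obtain G :: "real \<times> real \<Rightarrow> real^2" where G: "frame G" "G (0, norm (x n)) = x n"
    by (rule frame2_exists)
  obtain z where z: "\<And>i. G (z i) = x i" "z n = (0, norm (x n))"
    using frame_preimages[of G "(0, norm (x n))" x n] G by metis
  have "measure lebesgue (segment_sum (Suc n) x)
      = measure lebesgue (segment_sum n x) + norm (x n) * (\<Sum>i<n. \<bar>fst (z i)\<bar>)"
    using measure_segment_sum_Suc[OF G(1), of z n "norm (x n)"] by (simp add: z length_segment_sum)
  also have "norm (x n) * (\<Sum>i<n. \<bar>fst (z i)\<bar>) = (\<Sum>i<n. \<bar>cross2 (x i) (x n)\<bar>)"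
    using abs_cross2_frame[OF G(1), of "norm (x n)" "z i" for i] G(2) z(1)
    by (simp add: sum_distrib_left)
  finally show ?case
    by (subst sum2_lessThan_Suc) (simp_all add: Suc cross2_def abs_minus_commute mult.commute)
qed simp

text \<open>The same induction one dimension higher: the shadow along \<open>x n\<close> is a planar
  sum of segments, whose area is given by \<open>area_segment_sum\<close>.\<close>

lemma volume_segment_sum:
  "measure lebesgue (segment_sum n x) = (\<Sum>i<n. \<Sum>j<n. \<Sum>k<n. \<bar>triple (x i) (x j) (x k)\<bar>) / 6"
proof (induction n)
  case (Suc n)
  obtain G :: "(real^2) \<times> real \<Rightarrow> real^3" where G: "frame G" "G (0, norm (x n)) = x n"
    by (rule frame3_exists)
  obtain z where z: "\<And>i. G (z i) = x i" "z n = (0, norm (x n))"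
    using frame_preimages[of G "(0, norm (x n))" x n] G by metis
  have "measure lborel (segment_sum n (\<lambda>i. fst (z i))) = measure lebesgue (segment_sum n (\<lambda>i. fst (z i)))"
    by (intro measure_completion[symmetric]) (simp add: borel_compact compact_segment_sum)
  then have "measure lebesgue (segment_sum (Suc n) x)
      = measure lebesgue (segment_sum n x) + norm (x n) * ((\<Sum>i<n. \<Sum>j<n. \<bar>cross2 (fst (z i)) (fst (z j))\<bar>) / 2)"
    using measure_segment_sum_Suc[OF G(1), of z n "norm (x n)"] by (simp add: z area_segment_sum)
  also have "norm (x n) * ((\<Sum>i<n. \<Sum>j<n. \<bar>cross2 (fst (z i)) (fst (z j))\<bar>) / 2)
      = (\<Sum>i<n. \<Sum>j<n. \<bar>triple (x i) (x j) (x n)\<bar>) / 2"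
  proof -
    have "\<bar>triple (x i) (x j) (x n)\<bar> = norm (x n) * \<bar>cross2 (fst (z i)) (fst (z j))\<bar>" for i j
      using abs_triple_frame[OF G(1), of "norm (x n)" "z i" "z j"] G(2) z(1) by simp
    then show ?thesis by (simp add: sum_distrib_left)
  qed
  finally show ?case
    by (subst sum3_lessThan_Suc)
      (simp_all add: Suc triple_def cross3_simps abs_minus_commute)
qed simp

section \<open>Areas of orthogonal projections\<close>

text \<open>With \<open>plane_area_eq\<close>, this lets plane areas be computed in the horizontal
  coordinates of a frame whose vertical axis is the projection direction.\<close>

lemma frame_chart:
  assumes G: "frame G"
  shows "plane_chart (G (0, 1)) (\<lambda>y. G (y, 0))"
proof -
  have lin: "linear G" and inner: "\<And>v w. G v \<bullet> G w = v \<bullet> w" and surj: "surj G"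
    using G frame_linear frame_inner unfolding frame_def by blast+
  have "linear (\<lambda>y. G (y, 0))"
    by (intro linear_compose[OF _ lin, unfolded o_def]) (auto intro!: linearI)
  moreover have "x \<in> range (\<lambda>y. G (y, 0)) \<longleftrightarrow> orthogonal (G (0, 1)) x" for x
  proof -
    obtain y c where x: "x = G (y, c)" using surj by (metis surjD surj_pair)
    have eq: "G (y, c) = G (y', 0) \<longleftrightarrow> (y, c) = (y', 0)" for y'
      using inner by (metis vector_eq)
    have "x \<in> range (\<lambda>y. G (y, 0)) \<longleftrightarrow> c = 0"
      unfolding x image_iff by (simp add: eq)
    then show ?thesis by (simp add: x orthogonal_def inner)
  qed
  ultimately show ?thesis
    by (auto simp: plane_chart_def orthogonal_transformation_def inner perp_plane_def)
qed

lemma frame_perp_proj: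
  assumes G: "frame G"
  shows "(\<lambda>y. G (y, 0)) -` (perp_proj (G (0, 1)) ` G ` S) = fst ` S"
proof -
  have lin: "linear G" and inner: "\<And>v w. G v \<bullet> G w = v \<bullet> w"
    using G frame_linear frame_inner by blast+
  have "perp_proj (G (0, 1)) (G p) = G (fst p, 0)" for p
    by (cases p) (simp add: perp_proj_def inner flip: linear_diff[OF lin] linear_scale[OF lin])
  then have "perp_proj (G (0, 1)) ` G ` S = (\<lambda>y. G (y, 0)) ` fst ` S"
    by (simp add: image_image)
  moreover have "inj (\<lambda>y. G (y, 0))"
    using inner by (intro injI) (metis prod.inject vector_eq)
  ultimately show ?thesis by (simp add: inj_vimage_image_eq)
qed

lemma plane_area_segment_sum:
  assumes "norm u = 1"
  shows "plane_area u (perp_proj u ` segment_sum n x) = (\<Sum>i<n. \<Sum>j<n. \<bar>triple (x i) (x j) u\<bar>) / 2"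
proof -
  obtain G :: "(real^2) \<times> real \<Rightarrow> real^3" where "frame G" "G (0, norm u) = u"
    by (rule frame3_exists)
  then have G: "frame G" "G (0, 1) = u" using assms by auto
  define y where "y i = inv G (x i)" for i
  have "surj G" using G(1) by (simp add: frame_def)
  then have x: "x = (\<lambda>i. G (y i))" by (simp add: y_def surj_f_inv_f)
  have lin: "linear G" using G(1) by (rule frame_linear)
  have "plane_area u (perp_proj u ` segment_sum n x) = measure lebesgue (fst ` segment_sum n y)"
    using plane_area_eq[OF frame_chart[OF G(1)]] frame_perp_proj[OF G(1)]
    by (simp add: G(2) x linear_image_segment_sum[OF lin, symmetric])
  also have "\<dots> = (\<Sum>i<n. \<Sum>j<n. \<bar>cross2 (fst (y i)) (fst (y j))\<bar>) / 2"
    by (simp add: linear_image_segment_sum[OF linear_fst] area_segment_sum)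
  also have "\<dots> = (\<Sum>i<n. \<Sum>j<n. \<bar>triple (x i) (x j) u\<bar>) / 2"
    using abs_triple_frame[OF G(1), of 1] by (simp add: G(2) x)
  finally show ?thesis .
qed

text \<open>The map \<open>L\<close> reads off the horizontal coordinates in a frame with vertical
  axis \<open>u\<close>. It expresses shadows of arbitrary sets as images under one linear map, and
  the norm bound keeps neighbourhoods of radius \<open>r\<close> within radius
  \<open>r\<close>.\<close>

lemma plane_area_as_linear_image:
  assumes "norm u = 1"
  shows "\<exists>L :: real^3 \<Rightarrow> real^2. linear L \<and> (\<forall>x. norm (L x) \<le> norm x) \<and>
    (\<forall>S. plane_area u (perp_proj u ` S) = measure lebesgue (L ` S))"
proof -
  obtain G :: "(real^2) \<times> real \<Rightarrow> real^3" where "frame G" "G (0, norm u) = u"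
    by (rule frame3_exists)
  then have G: "frame G" "G (0, 1) = u" using assms by auto
  have lin: "linear G" using G(1) by (rule frame_linear)
  have "inj G" using frame_inner[OF G(1)] by (intro injI) (metis vector_eq)
  then obtain g where g: "linear g" "g \<circ> G = id"
    using linear_injective_left_inverse[OF lin] by blast
  have "surj G" using G(1) by (simp add: frame_def)
  then have Gg: "G (g x) = x" for x
    using g(2) by (metis comp_apply id_apply surjD)
  have "norm (g x) = norm x" for x
    using frame_inner[OF G(1), of "g x" "g x"] by (simp add: Gg norm_eq_sqrt_inner)
  then have "norm (fst (g x)) \<le> norm x" for x
    by (metis norm_fst_le prod.collapse)
  moreover have "plane_area u (perp_proj u ` S) = measure lebesgue ((\<lambda>x. fst (g x)) ` S)" for S
    using plane_area_eq[OF frame_chart[OF G(1)]] frame_perp_proj[OF G(1), of "g ` S"]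
    by (simp add: G(2) image_image Gg)
  moreover have "linear (\<lambda>x. fst (g x))"
    using linear_compose[OF g(1) linear_fst] by (simp add: o_def)
  ultimately show ?thesis by blast
qed

section \<open>Monotonicity of the volume to shadow ratio under added segments\<close>

text \<open>Expanding volume and shadow area in the new generator, the common term
  \<open>V * S u\<close> cancels, and what remains is \<open>triple_sum_le\<close> with
  \<open>v = x n\<close>.\<close>

lemma segment_sum_add_generator:
  assumes "norm u = 1"
  shows "measure lebesgue (segment_sum n x) * plane_area u (perp_proj u ` segment_sum (Suc n) x)
    \<le> measure lebesgue (segment_sum (Suc n) x) * plane_area u (perp_proj u ` segment_sum n x)"
proof -
  define V where "V = (\<Sum>i<n. \<Sum>j<n. \<Sum>k<n. \<bar>triple (x i) (x j) (x k)\<bar>)"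
  define S where "S w = (\<Sum>i<n. \<Sum>j<n. \<bar>triple (x i) (x j) w\<bar>)" for w
  define W where "W = (\<Sum>i<n. \<bar>triple (x i) u (x n)\<bar>)"
  have sym: "\<bar>triple a b c\<bar> = \<bar>triple b a c\<bar>" "\<bar>triple a b c\<bar> = \<bar>triple a c b\<bar>"
    "triple a b b = 0" "triple b b a = 0" for a b c
    by (simp_all add: triple_def cross3_simps abs_minus_commute)
  have "(\<Sum>i<Suc n. \<Sum>j<Suc n. \<Sum>k<Suc n. \<bar>triple (x i) (x j) (x k)\<bar>) = V + 3 * S (x n)"
    unfolding V_def S_def by (rule sum3_lessThan_Suc) (rule sym, rule sym, simp add: sym(3))
  moreover have "(\<Sum>i<Suc n. \<Sum>j<Suc n. \<bar>triple (x i) (x j) u\<bar>) = S u + 2 * W"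
    unfolding S_def W_def sym(2)[of _ u "x n"]
    by (rule sum2_lessThan_Suc) (rule sym, simp add: sym(4))
  moreover have "2 * V * W \<le> 3 * S u * S (x n)"
    unfolding V_def W_def S_def by (rule triple_sum_le) simp
  ultimately show ?thesis
    unfolding volume_segment_sum plane_area_segment_sum[OF assms] V_def[symmetric] S_def[symmetric]
    by (simp add: field_simps)
qed

lemma segment_sum_add_generators:
  assumes "norm u = 1" "0 < plane_area u (perp_proj u ` segment_sum n x)"
  shows "measure lebesgue (segment_sum n x) * plane_area u (perp_proj u ` segment_sum (n + m) x)
    \<le> measure lebesgue (segment_sum (n + m) x) * plane_area u (perp_proj u ` segment_sum n x)"
proof -
  define V where "V k = measure lebesgue (segment_sum k x)" for k
  define S where "S k = plane_area u (perp_proj u ` segment_sum k x)" for k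
  \<comment> \<open>Shadows grow with each generator, so all later shadow areas stay positive and
    can be cancelled.\<close>
  have "S k \<le> S (Suc k)" for k
    unfolding S_def plane_area_segment_sum[OF assms(1)] by (simp add: sum_nonneg sum_mono add_increasing2)
  then have "mono S" by (simp add: mono_iff_le_Suc)
  have "V n * S (n + m) \<le> V (n + m) * S n"
  proof (induction m)
    case (Suc m)
    have pos: "0 < S (n + m)"
      using assms(2) monoD[OF \<open>mono S\<close>, of n "n + m"] by (simp add: S_def)
    \<comment> \<open>Multiplying by the intermediate area \<open>S (n + m)\<close> links the two
      cross-multiplied inequalities; it is cancelled at the end.\<close>
    have "(V n * S (n + Suc m)) * S (n + m) = (V n * S (n + m)) * S (n + Suc m)" by simp
    also have "\<dots> \<le> (V (n + m) * S n) * S (n + Suc m)"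
      by (intro mult_right_mono Suc) (simp add: S_def plane_area_def)
    also have "\<dots> = S n * (V (n + m) * S (Suc (n + m)))" by simp
    also have "\<dots> \<le> S n * (V (Suc (n + m)) * S (n + m))"
      unfolding V_def S_def by (intro mult_left_mono segment_sum_add_generator assms) (simp add: plane_area_def)
    finally have "(V n * S (n + Suc m)) * S (n + m) \<le> (V (n + Suc m) * S n) * S (n + m)"
      by (simp add: mult_ac)
    then show ?case using pos by (simp add: mult_le_cancel_right)
  qed simp
  then show ?thesis by (simp add: V_def S_def)
qed

lemma segment_sum_append: "segment_sum n x + segment_sum m y = segment_sum (n + m) (\<lambda>i. if i < n then x i else y (i - n))"
proof (induction m)
  case 0
  have "segment_sum n x = segment_sum n (\<lambda>i. if i < n then x i else y (i - n))"
    unfolding segment_sum_def by (intro sum.cong) auto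
  then show ?case by (simp flip: set_zero)
next
  case (Suc m)
  have "segment_sum n x + segment_sum (Suc m) y = (segment_sum n x + segment_sum m y) + closed_segment 0 (y m)"
    by (simp add: segment_sum_Suc add.assoc)
  then show ?case by (simp only: Suc add_Suc_right segment_sum_Suc) simp
qed

text \<open>The point \<open>c\<close> collects the starting points of the segments; volumes and
  shadow areas do not depend on it.\<close>

definition is_segment_sum :: "'a::real_vector set \<Rightarrow> bool" where
  "is_segment_sum Z \<longleftrightarrow> (\<exists>c n x. Z = {c} + segment_sum n x)"

section \<open>From sums of segments to zonoids\<close>

lemma singleton_plus: "{c} + S = (+) c ` S" for c :: "'a::plus"
  by (auto simp: set_plus_def)

lemma is_segment_sum_segment: "is_segment_sum (closed_segment a b)" for a b :: "'a::real_vector"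
proof -
  have "segment_sum 1 (\<lambda>_. b - a) = closed_segment 0 (b - a)" by (simp add: segment_sum_def)
  then have "closed_segment a b = {a} + segment_sum 1 (\<lambda>_. b - a)"
    using closed_segment_translation[of a 0 "b - a"] by (simp add: singleton_plus)
  then show ?thesis unfolding is_segment_sum_def by blast
qed

lemma is_segment_sum_add: "is_segment_sum (Z + W)" if ZW: "is_segment_sum Z" "is_segment_sum W" for Z W :: "'a::real_vector set"
proof -
  obtain c n x d m y where "Z = {c} + segment_sum n x" "W = {d} + segment_sum m y"
    using ZW unfolding is_segment_sum_def by blast
  then have "Z + W = ({c} + {d}) + (segment_sum n x + segment_sum m y)" by (simp add: ac_simps)
  then have "Z + W = {c + d} + segment_sum (n + m) (\<lambda>i. if i < n then x i else y (i - n))"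
    by (simp add: segment_sum_append singleton_plus[of c "{d}"])
  then show ?thesis unfolding is_segment_sum_def by blast
qed

lemma is_segment_sum_sum: "is_segment_sum (\<Sum>i\<in>I. S i)" if "\<And>i. i \<in> I \<Longrightarrow> is_segment_sum (S i)"
  for S :: "'i \<Rightarrow> 'a::real_vector set"
  using that
proof (induction I rule: infinite_finite_induct)
  case (insert i I)
  then show ?case by (simp add: is_segment_sum_add)
qed (use is_segment_sum_segment[of 0 0] in \<open>simp_all add: set_zero\<close>)

lemma zonotope_is_segment_sum: "zonotope Z \<Longrightarrow> is_segment_sum Z"
  unfolding zonotope_def by (auto intro!: is_segment_sum_sum is_segment_sum_segment)

lemma is_segment_sum_compact: "is_segment_sum Z \<Longrightarrow> compact Z" for Z :: "'a::euclidean_space set"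
  unfolding is_segment_sum_def by (auto intro!: compact_set_plus compact_segment_sum)

lemma segment_sum_nonempty: "segment_sum n x \<noteq> {}"
  by (induction n) (auto simp: segment_sum_Suc set_plus_def)

lemma is_segment_sum_nonempty: "is_segment_sum Z \<Longrightarrow> Z \<noteq> {}"
  unfolding is_segment_sum_def by (auto simp: segment_sum_nonempty singleton_plus)

section \<open>Outer approximation of zonoids\<close>

text \<open>The cube with half side \<open>d\<close> is a sum of segments along the axes. It stands
  in for a ball when a zonotope has to be enlarged and remain a zonotope.\<close>

lemma cube_exists:
  fixes d :: real
  assumes "0 \<le> d"
  obtains C :: "'a::euclidean_space set"
  where "is_segment_sum C" "cball 0 d \<subseteq> C" "C \<subseteq> cball 0 (DIM('a) * d)"
proof
  define C :: "'a set" where "C = (\<Sum>b\<in>Basis. closed_segment (- d *\<^sub>R b) (d *\<^sub>R b))"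
  have C: "C = {sum s Basis | s. \<forall>b\<in>Basis. s b \<in> closed_segment (- d *\<^sub>R b) (d *\<^sub>R b)}"
    unfolding C_def by (rule set_sum_alt) simp
  have seg: "closed_segment (- d *\<^sub>R b) (d *\<^sub>R b) = (\<lambda>r. r *\<^sub>R b) ` {- d..d}" for b :: 'a
    using closed_segment_linear_image[of "\<lambda>r. r *\<^sub>R b" "- d" d] assms
    by (simp add: closed_segment_eq_real_ivl linear_scale_left)
  show "is_segment_sum C" unfolding C_def by (intro is_segment_sum_sum is_segment_sum_segment)
  show "cball 0 d \<subseteq> C"
  proof
    fix x :: 'a assume "x \<in> cball 0 d"
    then have "x \<bullet> b \<in> {- d..d}" if "b \<in> Basis" for b
      using Basis_le_norm[OF that, of x] by (simp add: abs_le_iff)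
    then have "\<forall>b\<in>Basis. (x \<bullet> b) *\<^sub>R b \<in> closed_segment (- d *\<^sub>R b) (d *\<^sub>R b)"
      unfolding seg by blast
    then have "(\<Sum>b\<in>Basis. (x \<bullet> b) *\<^sub>R b) \<in> C" unfolding C by blast
    then show "x \<in> C" by (simp add: euclidean_representation)
  qed
  show "C \<subseteq> cball 0 (DIM('a) * d)"
  proof
    fix x assume "x \<in> C"
    then obtain s where s: "x = sum s Basis" "\<And>b. b \<in> Basis \<Longrightarrow> s b \<in> (\<lambda>r. r *\<^sub>R b) ` {- d..d}"
      unfolding C seg by blast
    have "norm (s b) \<le> d" if "b \<in> Basis" for b
      using s(2)[OF that] that by auto
    then have "norm x \<le> (\<Sum>b\<in>(Basis :: 'a set). d)"
      unfolding s(1) by (rule sum_norm_le)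
    then show "x \<in> cball 0 (DIM('a) * d)" by simp
  qed
qed

text \<open>Compactness makes the suprema in \<open>hausdorff_dist\<close> genuine upper bounds and
  the distance to a set attained, so closed balls of exactly this radius suffice.\<close>

lemma subset_plus_cball:
  fixes A B :: "'a::euclidean_space set"
  assumes "compact A" "compact B" "A \<noteq> {}" "B \<noteq> {}"
  shows "A \<subseteq> B + cball 0 (hausdorff_dist A B)" "B \<subseteq> A + cball 0 (hausdorff_dist A B)"
proof -
  have *: "A \<subseteq> B + cball 0 r"
    if A: "compact A" "A \<noteq> {}" and B: "compact B" "B \<noteq> {}" and r: "(SUP x\<in>A. infdist x B) \<le> r"
    for A B :: "'a set" and r
  proof
    fix x assume "x \<in> A"
    have "compact ((\<lambda>x. infdist x B) ` A)"
      using A(1) by (intro compact_continuous_image continuous_intros)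
    then have "infdist x B \<le> (SUP x\<in>A. infdist x B)"
      using \<open>x \<in> A\<close> by (intro cSUP_upper) (auto intro: bounded_imp_bdd_above compact_imp_bounded)
    moreover obtain y where "y \<in> B" "infdist x B = dist x y"
      using infdist_attains_inf[OF compact_imp_closed[OF B(1)] B(2)] .
    ultimately have "x - y \<in> cball 0 r" using r by (simp add: dist_norm norm_minus_commute)
    then have "y + (x - y) \<in> B + cball 0 r" using \<open>y \<in> B\<close> by (intro set_plus_intro)
    then show "x \<in> B + cball 0 r" by simp
  qed
  show "A \<subseteq> B + cball 0 (hausdorff_dist A B)" "B \<subseteq> A + cball 0 (hausdorff_dist A B)"
    unfolding hausdorff_dist_def
    by (rule *[OF assms(1,3,2,4) max.cobounded1], rule *[OF assms(2,4,1,3) max.cobounded2])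
qed

lemma cball_plus_cball:
  fixes r s :: real
  shows "cball (0::'a::real_normed_vector) r + cball 0 s \<subseteq> cball 0 (r + s)"
  by (auto elim!: set_plus_elim intro: norm_triangle_mono)

text \<open>A zonotope close to \<open>K\<close> need not contain it, but it does after a small cube
  is added. Inclusions on both sides let the main proof work with monotonicity of measure.\<close>

lemma zonoid_outer_approximation:
  fixes K :: "'a::euclidean_space set"
  assumes "zonoid K" "0 < e"
  obtains Z where "is_segment_sum Z" "K \<subseteq> Z" "Z \<subseteq> K + cball 0 e"
proof -
  \<comment> \<open>The zonotope costs \<open>d\<close> and the cube \<open>DIM('a) * d\<close>,
    which adds up to \<open>e\<close>.\<close>
  define d where "d = e / (1 + DIM('a))"
  have "0 < d" using assms(2) by (simp add: d_def)
  obtain Z' :: "nat \<Rightarrow> 'a set" where Z': "\<And>n. zonotope (Z' n)" "(\<lambda>n. hausdorff_dist (Z' n) K) \<longlonglongrightarrow> 0"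
    and K: "compact K" "K \<noteq> {}"
    using assms(1) unfolding zonoid_def by blast
  obtain n where n: "hausdorff_dist (Z' n) K < d"
    using order_tendstoD(2)[OF Z'(2) \<open>0 < d\<close>] by (auto simp: eventually_sequentially)
  have zn: "is_segment_sum (Z' n)" using Z'(1) by (rule zonotope_is_segment_sum)
  have cb: "cball 0 (hausdorff_dist (Z' n) K) \<subseteq> cball (0::'a) d" using n by auto
  have sub: "Z' n \<subseteq> K + cball 0 d" "K \<subseteq> Z' n + cball 0 d"
    using subset_plus_cball[OF is_segment_sum_compact[OF zn] K(1) is_segment_sum_nonempty[OF zn] K(2)]
      set_plus_mono2[OF subset_refl cb] by blast+
  obtain C :: "'a set" where C: "is_segment_sum C" "cball 0 d \<subseteq> C" "C \<subseteq> cball 0 (DIM('a) * d)"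
    using cube_exists[of d] \<open>0 < d\<close> by auto
  show thesis
  proof
    show "is_segment_sum (Z' n + C)" using zn C(1) by (rule is_segment_sum_add)
    show "K \<subseteq> Z' n + C" using sub(2) set_plus_mono2[OF subset_refl C(2)] by blast
    have "Z' n + C \<subseteq> (K + cball 0 d) + cball 0 (DIM('a) * d)"
      using sub(1) C(3) by (rule set_plus_mono2)
    also have "\<dots> = K + (cball 0 d + cball 0 (DIM('a) * d))" by (simp add: add.assoc)
    also have "\<dots> \<subseteq> K + cball 0 (d + DIM('a) * d)"
      by (intro set_plus_mono2 subset_refl cball_plus_cball)
    also have "d + DIM('a) * d = d * (1 + DIM('a))" by (simp add: algebra_simps)
    also have "\<dots> = e" by (simp add: d_def add_pos_nonneg less_imp_neq[symmetric])
    finally show "Z' n + C \<subseteq> K + cball 0 e" .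
  qed
qed

text \<open>A compact set is the intersection of its shrinking closed neighbourhoods, which have
  finite measure, so continuity from above applies.\<close>

lemma measure_plus_cball_tendsto:
  fixes K :: "'a::euclidean_space set"
  assumes K: "compact K" and "0 \<le> c"
  shows "(\<lambda>n. measure lebesgue (K + cball 0 (c / Suc n))) \<longlonglongrightarrow> measure lebesgue K"
proof -
  have comp: "compact (K + cball 0 r)" for r using K by (intro compact_set_plus) auto
  have "(\<Inter>n. K + cball 0 (c / Suc n)) \<subseteq> K"
  proof
    fix x assume x: "x \<in> (\<Inter>n. K + cball 0 (c / Suc n))"
    then have "x \<in> K + cball 0 (c / Suc 0)" by blast
    \<comment> \<open>The value of \<open>infdist\<close> to the empty set is 0 by convention, so
      nonemptiness is secured before distance 0 is used to conclude membership.\<close>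
    then have "K \<noteq> {}" by (auto simp: set_plus_def)
    have "infdist x K \<le> c / Suc n" for n
    proof -
      have "x \<in> K + cball 0 (c / Suc n)" using x by blast
      then obtain y z where "x = y + z" "y \<in> K" "z \<in> cball 0 (c / Suc n)" by (rule set_plus_elim)
      then show ?thesis using infdist_le[OF \<open>y \<in> K\<close>, of x] by (simp add: dist_norm)
    qed
    moreover have "(\<lambda>n. c / Suc n) \<longlonglongrightarrow> 0"
      using LIMSEQ_Suc[OF lim_const_over_n[of c]] by simp
    ultimately have "infdist x K \<le> 0" by (intro LIMSEQ_le_const) auto
    then show "x \<in> K"
      using in_closed_iff_infdist_zero[OF compact_imp_closed[OF K] \<open>K \<noteq> {}\<close>, of x] infdist_nonneg[of x K] by simp
  qed
  moreover have "K \<subseteq> K + cball 0 (c / Suc n)" for n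
    using \<open>0 \<le> c\<close> set_zero_plus2[of "cball 0 (c / Suc n)" K] by (simp add: add.commute)
  ultimately have "(\<Inter>n. K + cball 0 (c / Suc n)) = K" by blast
  moreover have "(\<lambda>n. measure lebesgue (K + cball 0 (c / Suc n)))
      \<longlonglongrightarrow> measure lebesgue (\<Inter>n. K + cball 0 (c / Suc n))"
  proof (rule Lim_measure_decseq)
    show "range (\<lambda>n. K + cball 0 (c / Suc n)) \<subseteq> sets lebesgue"
      using comp by (auto intro: lmeasurable_compact fmeasurableD)
    show "decseq (\<lambda>n. K + cball 0 (c / Suc n))"
    proof (rule decseq_SucI, rule set_plus_mono2)
      fix n
      have "c / Suc (Suc n) \<le> c / Suc n" using \<open>0 \<le> c\<close> by (intro divide_left_mono) auto
      then show "cball (0::'a) (c / Suc (Suc n)) \<subseteq> cball 0 (c / Suc n)" by (rule subset_cball)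
    qed simp
    show "emeasure lebesgue (K + cball 0 (c / Suc i)) \<noteq> \<infinity>" for i
      using comp lmeasurable_compact fmeasurableD2 by (metis infinity_ennreal_def)
  qed
  ultimately show ?thesis by simp
qed

lemma measure_plus_singleton: "measure lebesgue ({c} + S) = measure lebesgue S"
  for c :: "'a::euclidean_space"
  by (simp add: singleton_plus measure_translation)

lemma measure_mono_compact:
  fixes S T :: "'a::euclidean_space set"
  assumes "S \<subseteq> T" "compact S" "compact T"
  shows "measure lebesgue S \<le> measure lebesgue T"
  using assms by (intro measure_mono_fmeasurable) (auto intro: lmeasurable_compact fmeasurableD)

lemma compact_linear_image_eucl:
  fixes L :: "'a::euclidean_space \<Rightarrow> 'b::euclidean_space"
  assumes "linear L" "compact S"
  shows "compact (L ` S)"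
  using assms by (intro compact_continuous_image linear_continuous_on) (simp_all add: linear_conv_bounded_linear)

text \<open>Concatenating the generators of \<open>Z\<close> and \<open>W\<close> reduces this to
  \<open>segment_sum_add_generators\<close>; the translations drop out by invariance of
  measure.\<close>

lemma is_segment_sum_volume_area:
  fixes Z W :: "(real^3) set"
  assumes "is_segment_sum Z" "is_segment_sum W" "norm u = 1" "linear L"
    and L: "\<And>S. plane_area u (perp_proj u ` S) = measure lebesgue (L ` S)"
    and pos: "0 < measure lebesgue (L ` Z)"
  shows "measure lebesgue Z * measure lebesgue (L ` (Z + W))
    \<le> measure lebesgue (Z + W) * measure lebesgue (L ` Z)"
proof -
  obtain c n x d m y where ZW: "Z = {c} + segment_sum n x" "W = {d} + segment_sum m y"
    using assms(1,2) unfolding is_segment_sum_def by blast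
  define z where "z i = (if i < n then x i else y (i - n))" for i
  have "segment_sum n x = segment_sum n z"
    unfolding segment_sum_def z_def by (intro sum.cong) auto
  with ZW have Z: "Z = {c} + segment_sum n z" by simp
  have "Z + W = ({c} + {d}) + (segment_sum n x + segment_sum m y)" using ZW by (simp add: ac_simps)
  then have ZW: "Z + W = {c + d} + segment_sum (n + m) z"
    by (simp add: segment_sum_append z_def[abs_def] singleton_plus[of c "{d}"])
  have "measure lebesgue (L ` ({a} + S)) = measure lebesgue (L ` S)" for a S
    by (simp add: linear_image_set_plus[OF \<open>linear L\<close>] measure_plus_singleton)
  then show ?thesis
    using segment_sum_add_generators[OF \<open>norm u = 1\<close>, of n z m] pos
    unfolding Z[symmetric] ZW unfolding Z by (simp add: measure_plus_singleton L)
qed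

theorem mainTheorem8:
  fixes A B :: "(real^3) set" and u :: "real^3"
  assumes "zonoid A" and "zonoid B"
    and "norm u = 1"
    and "plane_area u (perp_proj u ` A) > 0"
  shows "measure lebesgue (A + B) / plane_area u (perp_proj u ` (A + B))
           \<ge> measure lebesgue A / plane_area u (perp_proj u ` A)"
proof -
  obtain L :: "real^3 \<Rightarrow> real^2" where lin: "linear L" and norm_L: "\<And>x. norm (L x) \<le> norm x"
    and L: "\<And>S. plane_area u (perp_proj u ` S) = measure lebesgue (L ` S)"
    using plane_area_as_linear_image[OF assms(3)] by blast
  have comp: "compact A" "compact B" and "B \<noteq> {}"
    using assms(1,2) by (auto simp: zonoid_def)
  note comp_L = compact_linear_image_eucl[OF lin]
  have L_cball: "L ` (S + cball 0 r) \<subseteq> L ` S + cball 0 r" for S r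
    unfolding linear_image_set_plus[OF lin]
    by (intro set_plus_mono2 subset_refl) (auto intro: order_trans[OF norm_L])
  have posA: "0 < measure lebesgue (L ` A)" using assms(4) by (simp add: L)
  \<comment> \<open>The claim is proved in cross-multiplied form, so no quotient has to be
    controlled in the limit. The radius is \<open>2 / Suc n\<close> since the approximations of
    \<open>A\<close> and \<open>B\<close> each contribute \<open>1 / Suc n\<close>.\<close>
  have "measure lebesgue A * measure lebesgue (L ` (A + B))
      \<le> measure lebesgue ((A + B) + cball 0 (2 / Suc n)) * measure lebesgue (L ` A + cball 0 (1 / Suc n))" for n
  proof -
    have "0 < 1 / Suc n" by simp
    obtain Z where Z: "is_segment_sum Z" "A \<subseteq> Z" "Z \<subseteq> A + cball 0 (1 / Suc n)"
      using zonoid_outer_approximation[OF assms(1) \<open>0 < 1 / Suc n\<close>] .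
    obtain W where W: "is_segment_sum W" "B \<subseteq> W" "W \<subseteq> B + cball 0 (1 / Suc n)"
      using zonoid_outer_approximation[OF assms(2) \<open>0 < 1 / Suc n\<close>] .
    note compZ = is_segment_sum_compact[OF Z(1)] and compW = is_segment_sum_compact[OF W(1)]
    have "Z + W \<subseteq> (A + cball 0 (1 / Suc n)) + (B + cball 0 (1 / Suc n))"
      using Z(3) W(3) by (rule set_plus_mono2)
    also have "\<dots> = (A + B) + (cball 0 (1 / Suc n) + cball 0 (1 / Suc n))" by (simp add: ac_simps)
    also have "\<dots> \<subseteq> (A + B) + cball 0 (1 / Suc n + 1 / Suc n)"
      by (intro set_plus_mono2 subset_refl cball_plus_cball)
    finally have ZW: "Z + W \<subseteq> (A + B) + cball 0 (2 / Suc n)" by simp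
    have LZ: "L ` Z \<subseteq> L ` A + cball 0 (1 / Suc n)"
      using Z(3) L_cball[of A "1 / Suc n"] by blast
    have "measure lebesgue (L ` A) \<le> measure lebesgue (L ` Z)"
      using Z(2) comp compZ by (intro measure_mono_compact comp_L) auto
    then have "0 < measure lebesgue (L ` Z)" using posA by linarith
    have "measure lebesgue A * measure lebesgue (L ` (A + B))
        \<le> measure lebesgue Z * measure lebesgue (L ` (Z + W))"
      using Z(2) W(2) comp compZ compW
      by (intro mult_mono measure_mono_compact comp_L image_mono set_plus_mono2 compact_set_plus) auto
    also have "\<dots> \<le> measure lebesgue (Z + W) * measure lebesgue (L ` Z)"
      by (rule is_segment_sum_volume_area) fact+
    also have "\<dots> \<le> measure lebesgue ((A + B) + cball 0 (2 / Suc n)) * measure lebesgue (L ` A + cball 0 (1 / Suc n))"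
      using ZW LZ comp compZ compW
      by (intro mult_mono measure_mono_compact comp_L compact_set_plus) auto
    finally show ?thesis .
  qed
  moreover have "(\<lambda>n. measure lebesgue ((A + B) + cball 0 (2 / Suc n)) * measure lebesgue (L ` A + cball 0 (1 / Suc n)))
      \<longlonglongrightarrow> measure lebesgue (A + B) * measure lebesgue (L ` A)"
    using comp by (intro tendsto_mult measure_plus_cball_tendsto compact_set_plus comp_L) auto
  ultimately have main: "measure lebesgue A * measure lebesgue (L ` (A + B))
      \<le> measure lebesgue (A + B) * measure lebesgue (L ` A)"
    by (intro LIMSEQ_le_const) auto
  \<comment> \<open>The sum \<open>A + B\<close> contains a translate of \<open>A\<close>, so its
    shadow has positive area and dividing by it is legitimate.\<close>
  obtain b where "b \<in> B" using \<open>B \<noteq> {}\<close> by blast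
  have "measure lebesgue (L ` A) = measure lebesgue ({L b} + L ` A)"
    by (simp add: measure_plus_singleton)
  also have "\<dots> \<le> measure lebesgue (L ` (A + B))"
  proof (rule measure_mono_compact)
    have "{L b} + L ` A \<subseteq> L ` B + L ` A" using \<open>b \<in> B\<close> by (intro set_plus_mono2) auto
    then show "{L b} + L ` A \<subseteq> L ` (A + B)"
      by (simp add: linear_image_set_plus[OF lin] add.commute)
  qed (use comp in \<open>auto intro!: compact_set_plus comp_L\<close>)
  finally have "0 < measure lebesgue (L ` (A + B))" using posA by linarith
  with main posA show ?thesis
    unfolding L by (simp add: field_simps)
qed

end
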